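(* Let $A$ be a normed $\Omega$-group. Let $(a_n)$ be a sequence in $A$ which converges, with $\lim_{n\to\infty} a_n = a$, and let $(b_n)$ be a sequence in $A$ which converges, with $\lim_{n\to\infty} b_n = b$. Then the sequence $(a_n+b_n)$ converges and $$\lim_{n\to\infty}(a_n+b_n)=a+b.$$
   Context: $\Omega$ is a set of operation symbols, each with an arity $n\ge 1$. A map $A^n\to A$ is polyadditive if it is additive in each argument separately. An $\Omega$-group is a set $A$ with an additive group structure, together with, for each $n$-ary $\omega\in\Omega$, a polyadditive $n$-ary operation on $A$, written $(a_1,\dots,a_n)\mapsto a_1\dots a_n\omega$. Throughout, the additive group is assumed abelian. A norm on $A$ is a map $\|\cdot\|:A\to\mathbb{R}$ with $\|a\|\ge 0$; $\|a\|=0$ iff $a=0$; $\|a+b\|\le\|a\|+\|b\|$; $\|-a\|=\|a\|$. A normed $\Omega$-group is an $\Omega$-group with a norm, with the topology of the metric $d(a,b)=\|a-b\|$; a sequence $a_n$ converges to $a$ if for every real $\epsilon>0$ there is $n_0$ with $\|a_n-a\|<\epsilon$ for all $n>n_0$. Standing convention: the topology of a normed $\Omega$-group is $T_1$, second countable, and no singleton $\{x\}$ is open. *)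

theory Defs
  imports "HOL-Analysis.Analysis"
begin

text \<open>
  The carrier of the algebra is the whole type \<open>'a\<close>; its additive abelian group structure is the
  type class \<open>ab_group_add\<close>. An n-ary operation is a function on lists, of which only the
  values at lists of length n are relevant.
\<close>

definition polyadditive :: "nat \<Rightarrow> ('a::ab_group_add list \<Rightarrow> 'a) \<Rightarrow> bool" where
  "polyadditive n f \<longleftrightarrow>
    (\<forall>xs i x y. length xs = n \<longrightarrow> i < n \<longrightarrow>
      f (xs[i := x + y]) = f (xs[i := x]) + f (xs[i := y]))"

text \<open>\<open>\<Omega>\<close> is a set rather than a type so that it may be empty.\<close>

locale omega_group =
  fixes \<Omega> :: "'w set"
    and arity :: "'w \<Rightarrow> nat"
    and opr :: "'w \<Rightarrow> 'a::ab_group_add list \<Rightarrow> 'a"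
  assumes arity_pos: "\<omega> \<in> \<Omega> \<Longrightarrow> 1 \<le> arity \<omega>"
    and opr_polyadditive: "\<omega> \<in> \<Omega> \<Longrightarrow> polyadditive (arity \<omega>) (opr \<omega>)"

locale group_norm =
  fixes nrm :: "'a::ab_group_add \<Rightarrow> real"
  assumes nrm_nonneg: "0 \<le> nrm a"
    and nrm_eq_zero_iff: "nrm a = 0 \<longleftrightarrow> a = 0"
    and nrm_triangle: "nrm (a + b) \<le> nrm a + nrm b"
    and nrm_uminus: "nrm (- a) = nrm a"

sublocale group_norm \<subseteq> Metric_space UNIV "\<lambda>a b. nrm (a - b)"
proof
  show "0 \<le> nrm (x - y)" for x y
    by (rule nrm_nonneg)
  show "nrm (x - y) = nrm (y - x)" for x y
    using nrm_uminus[of "x - y"] by simp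
  show "nrm (x - y) = 0 \<longleftrightarrow> x = y" for x y
    by (simp add: nrm_eq_zero_iff)
  show "nrm (x - z) \<le> nrm (x - y) + nrm (y - z)" for x y z
    using nrm_triangle[of "x - y" "y - z"] by simp
qed

locale normed_omega_group = omega_group \<Omega> arity opr + group_norm nrm
  for \<Omega> :: "'w set"
    and arity :: "'w \<Rightarrow> nat"
    and opr :: "'w \<Rightarrow> 'a::ab_group_add list \<Rightarrow> 'a"
    and nrm :: "'a \<Rightarrow> real" +
  assumes topology_t1: "t1_space mtopology"
    and topology_second_countable: "second_countable mtopology"
    and singleton_not_open: "\<not> openin mtopology {x}"

definition norm_converges_to :: "('a::ab_group_add \<Rightarrow> real) \<Rightarrow> (nat \<Rightarrow> 'a) \<Rightarrow> 'a \<Rightarrow> bool" where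
  "norm_converges_to nrm X l \<longleftrightarrow> (\<forall>\<epsilon>>0. \<exists>n0. \<forall>n>n0. nrm (X n - l) < \<epsilon>)"

end

theory Submission
  imports Defs
begin

text \<open>The error of the sum is the sum of the errors: in an abelian group
  \<open>(X n + Y n) - (x + y)\<close> equals \<open>(X n - x) + (Y n - y)\<close>. The triangle
  inequality bounds its norm by two norms, each eventually below \<open>\<epsilon> / 2\<close>.
  \<open>norm_converges_to_add\<close> carries out this estimate for a normed abelian group, and the
  theorem inherits it because a normed \<Omega>-group contains one.\<close>

lemma (in group_norm) norm_converges_to_add:
  assumes X: "norm_converges_to nrm X x" and Y: "norm_converges_to nrm Y y"
  shows "norm_converges_to nrm (\<lambda>n. X n + Y n) (x + y)"
  unfolding norm_converges_to_def
proof (intro allI impI)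
  fix \<epsilon> :: real
  assume "\<epsilon> > 0"
  then have half: "\<epsilon> / 2 > 0" by simp
  obtain M where M: "\<forall>n>M. nrm (X n - x) < \<epsilon> / 2"
    using X half unfolding norm_converges_to_def by blast
  obtain N where N: "\<forall>n>N. nrm (Y n - y) < \<epsilon> / 2"
    using Y half unfolding norm_converges_to_def by blast
  \<comment> \<open>Beyond the larger threshold both half-\<epsilon> bounds hold at once.\<close>
  have "nrm (X n + Y n - (x + y)) < \<epsilon>" if "n > max M N" for n
  proof -
    have "nrm (X n + Y n - (x + y)) \<le> nrm (X n - x) + nrm (Y n - y)"
      \<comment> \<open>\<open>add_diff_add\<close> does the regrouping, which rests on
        commutativity of addition.\<close>
      using nrm_triangle[of "X n - x" "Y n - y"] by (simp add: add_diff_add)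
    moreover have "nrm (X n - x) < \<epsilon> / 2" "nrm (Y n - y) < \<epsilon> / 2"
      using M N that by auto
    ultimately show ?thesis by linarith
  qed
  then show "\<exists>n0. \<forall>n>n0. nrm (X n + Y n - (x + y)) < \<epsilon>" by blast
qed

theorem theorem2p4p3:
  fixes \<Omega> :: "'w set"
    and arity :: "'w \<Rightarrow> nat"
    and opr :: "'w \<Rightarrow> 'a::ab_group_add list \<Rightarrow> 'a"
    and nrm :: "'a \<Rightarrow> real"
    and a_seq b_seq :: "nat \<Rightarrow> 'a"
    and a b :: 'a
  assumes "normed_omega_group \<Omega> arity opr nrm"
    and "norm_converges_to nrm a_seq a"
    and "norm_converges_to nrm b_seq b"
  shows "norm_converges_to nrm (\<lambda>n. a_seq n + b_seq n) (a + b)"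
proof -
  interpret normed_omega_group \<Omega> arity opr nrm by fact
  show ?thesis using assms(2,3) by (rule norm_converges_to_add)
qed

end
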